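(* Let $\mathcal{J}:\mathbb{R}^n\to\mathbb{R}\cup\{\infty\}$ be coercive, proper, lower semi-continuous, and continuous on its domain $\operatorname{dom}\mathcal{J}$. Let $V_1,\dots,V_m\subset\mathbb{R}^n$ be linear subspaces with $\mathbb{R}^n=\sum_{k=1}^m V_k$ (not necessarily direct), and assume that for each $w\in\operatorname{dom}\mathcal{J}$ and each $k$ the function $V_k\ni v\mapsto\mathcal{J}(w+v)$ has a unique global minimizer. Assume that the decomposition $\mathbb{R}^n=\sum_{k=1}^mV_k$ is compatible with $\mathcal{J}$. Let $\mathcal{M}_k:\operatorname{dom}\mathcal{J}\to\operatorname{dom}\mathcal{J}$ satisfy $\mathcal{M}_k(w)-w\in V_k$ for all $w\in\operatorname{dom}\mathcal{J}$ ($k=1,\dots,m$), let $\mathcal{C}:\operatorname{dom}\mathcal{J}\to\operatorname{dom}\mathcal{J}$, let $u^0\in\operatorname{dom}\mathcal{J}$, and define $u^{\nu+1}=\mathcal{C}\bigl((\mathcal{M}_m\circ\dots\circ\mathcal{M}_1)(u^\nu)\bigr)$ for $\nu\ge0$. Assume that there are maps $\tilde{\mathcal{M}}_k:\operatorname{dom}\mathcal{J}\to\operatorname{dom}\mathcal{J}$ with $\tilde{\mathcal{M}}_k(w)-w\in V_k$ for all $w\in\operatorname{dom}\mathcal{J}$, such that for every $k$: 1. $\mathcal{J}(\mathcal{M}_k(v))\le\mathcal{J}(\tilde{\mathcal{M}}_k(v))\le\mathcal{J}(v)$ and $\mathcal{J}(\mathcal{C}(v))\le\mathcal{J}(v)$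 for all $v\in\operatorname{dom}\mathcal{J}$; 2. $\mathcal{J}\circ\tilde{\mathcal{M}}_k$ is continuous on $\operatorname{dom}\mathcal{J}$; 3. $\mathcal{J}(\tilde{\mathcal{M}}_k(v))<\mathcal{J}(v)$ for every $v\in\operatorname{dom}\mathcal{J}$ such that $\mathcal{J}(v)$ is not minimal in $v+V_k$. Then any accumulation point of $(u^\nu)$ is a global minimizer of $\mathcal{J}$.
   Context: $\operatorname{dom}\mathcal{J}=\{x\in\mathbb{R}^n : \mathcal{J}(x)<\infty\}$, with the topology induced from $\mathbb{R}^n$. Coercive means $\mathcal{J}(v)\to\infty$ as $\|v\|\to\infty$. "Continuous on its domain" means that the restriction of $\mathcal{J}$ to $\operatorname{dom}\mathcal{J}$ is continuous. The decomposition $\mathbb{R}^n=\sum_{k=1}^mV_k$ is called compatible with $\mathcal{J}$ if for every $u\in\operatorname{dom}\mathcal{J}$ the property "$\mathcal{J}(u)\le\mathcal{J}(u+v)$ for all $v\in V_k$, $k=1,\dots,m$" implies "$\mathcal{J}(u)\le\mathcal{J}(u+v)$ for all $v\in\mathbb{R}^n$". *)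

theory Defs
  imports "HOL-Analysis.Analysis" "HOL-Library.Set_Algebras" "HOL-Library.FuncSet"
begin

definition effective_domain :: "('a \<Rightarrow> ereal) \<Rightarrow> 'a set" where
  "effective_domain J = {x. J x < \<infinity>}"

(* The first conjunct excludes the value \<open>-\<infinity>\<close>, so a proper function is one with
   values in the reals extended by \<open>\<infinity>\<close> only. *)
definition proper :: "('a \<Rightarrow> ereal) \<Rightarrow> bool" where
  "proper J \<longleftrightarrow> (\<forall>x. J x \<noteq> -\<infinity>) \<and> effective_domain J \<noteq> {}"

definition coercive :: "('a::real_normed_vector \<Rightarrow> ereal) \<Rightarrow> bool" where
  "coercive J \<longleftrightarrow> (J \<longlongrightarrow> \<infinity>) at_infinity"

definition lower_semicontinuous :: "('a::topological_space \<Rightarrow> ereal) \<Rightarrow> bool" where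
  "lower_semicontinuous J \<longleftrightarrow> (\<forall>x. J x \<le> Liminf (at x) J)"

definition compatible ::
    "('a::real_vector \<Rightarrow> ereal) \<Rightarrow> nat \<Rightarrow> (nat \<Rightarrow> 'a set) \<Rightarrow> bool" where
  "compatible J m V \<longleftrightarrow>
     (\<forall>u\<in>effective_domain J.
        (\<forall>k\<in>{1..m}. \<forall>v\<in>V k. J u \<le> J (u + v)) \<longrightarrow> (\<forall>v. J u \<le> J (u + v)))"

definition accumulation_point :: "(nat \<Rightarrow> 'a::topological_space) \<Rightarrow> 'a \<Rightarrow> bool" where
  "accumulation_point u x \<longleftrightarrow> (\<exists>r. strict_mono r \<and> (u \<circ> r) \<longlonglongrightarrow> x)"

end

theory Submission
  imports Defs
begin

text \<open>The values of \<open>J\<close> decrease along the iteration, including its intermediate subspace steps, so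
  they all converge to \<open>J x\<close>. If the iterates after \<open>k\<close> subspace steps accumulate at \<open>x\<close>,
  then continuity of \<open>J \<circ> M' (k + 1)\<close> prevents a strict decrease at \<open>x\<close>, and \<open>x\<close>
  minimizes \<open>J\<close> in \<open>x + V (k + 1)\<close>. The iterates after the next step remain in a compact
  sublevel set. Any accumulation point of theirs lies in \<open>x + V (k + 1)\<close> and has the same energy,
  so it is \<open>x\<close> by uniqueness of the minimizer. By induction \<open>x\<close> is minimal
  in all subspace directions, and compatibility applies.\<close>

lemma closed_sublevel:
  assumes "lower_semicontinuous J"
  shows "closed {y. J y \<le> c}"
proof -
  have "open {y. c < J y}"
  proof (subst open_subopen, rule ballI)
    fix y assume "y \<in> {y. c < J y}"
    then have y: "c < J y"
      by simp
    also have "J y \<le> Liminf (at y) J"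
      using assms by (simp add: lower_semicontinuous_def)
    finally have "c < Liminf (at y) J" .
    then have "eventually (\<lambda>z. c < J z) (at y)"
      by (rule less_LiminfD)
    \<comment> \<open>The filter \<open>at y\<close> omits \<open>y\<close> itself; the strict
      inequality at \<open>y\<close> fills this gap, which gives a full neighbourhood.\<close>
    then have "eventually (\<lambda>z. z \<noteq> y \<longrightarrow> c < J z) (nhds y)"
      by (simp add: eventually_at_filter)
    then have "eventually (\<lambda>z. c < J z) (nhds y)"
      by (rule eventually_mono) (use y in blast)
    then show "\<exists>T. open T \<and> y \<in> T \<and> T \<subseteq> {y. c < J y}"
      by (auto simp: eventually_nhds)
  qed
  moreover have "{y. c < J y} = - {y. J y \<le> c}"
    by auto
  ultimately show ?thesis
    by (simp add: closed_def)
qed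

text \<open>Coercivity bounds the sublevel set and lower semicontinuity closes it, so Heine-Borel
  applies. The bound \<open>c < \<infinity>\<close> matters: the sublevel set of
  \<open>\<infinity>\<close> is the whole space.\<close>

lemma compact_sublevel:
  fixes J :: "'a::euclidean_space \<Rightarrow> ereal"
  assumes "coercive J" "lower_semicontinuous J" "c < \<infinity>"
  shows "compact {y. J y \<le> c}"
proof -
  have "eventually (\<lambda>y. c < J y) at_infinity"
    using assms(1,3) unfolding coercive_def by (rule order_tendstoD)
  then obtain b where b: "\<And>y. b \<le> norm y \<Longrightarrow> c < J y"
    unfolding eventually_at_infinity by blast
  have "bounded {y. J y \<le> c}"
    unfolding bounded_iff
  proof (intro exI ballI)
    fix y assume "y \<in> {y. J y \<le> c}"
    then show "norm y \<le> b"
      using b[of y] by (metis linorder_not_le mem_Collect_eq nle_le)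
  qed
  then show ?thesis
    using closed_sublevel[OF assms(2)] by (simp add: compact_eq_bounded_closed)
qed

text \<open>Here \<open>w\<close> and \<open>z\<close> stand for the iterates before and after a
  subspace step, taken along a subsequence, and \<open>T\<close> for the comparison map
  \<open>M'\<close>. The actual step may be discontinuous, so \<open>z\<close> is tied to
  \<open>w\<close> only through its direction and its energy.\<close>

lemma subspace_step:
  fixes J :: "'a::euclidean_space \<Rightarrow> ereal"
  assumes K: "compact {y. J y \<le> c}" "c < \<infinity>"
    and J: "continuous_on (effective_domain J) J"
    and V: "subspace V"
    and x: "x \<in> effective_domain J"
    and uniq: "\<exists>!v. is_arg_min (\<lambda>v. J (x + v)) (\<lambda>v. v \<in> V) v"
    and T: "continuous_on (effective_domain J) (J \<circ> T)"
      "\<not> is_arg_min J (\<lambda>y. y \<in> (+) x ` V) x \<Longrightarrow> J (T x) < J x"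
    and w: "\<And>j. w j \<in> effective_domain J" "w \<longlonglongrightarrow> x"
    and z: "\<And>j. J (z j) \<le> c" "\<And>j. z j - w j \<in> V" "\<And>j. J (z j) \<le> J (T (w j))"
      "(\<lambda>j. J (z j)) \<longlonglongrightarrow> J x"
  shows "is_arg_min J (\<lambda>y. y \<in> (+) x ` V) x"
    and "\<exists>s :: nat \<Rightarrow> nat. strict_mono s \<and> (z \<circ> s) \<longlonglongrightarrow> x"
proof -
  \<comment> \<open>The energies of \<open>z j\<close> tend to \<open>J x\<close> and are bounded by
    those of \<open>T (w j)\<close>, which tend to \<open>J (T x)\<close>. In the limit no strict
    decrease at \<open>x\<close> is left, and the contrapositive of \<open>T(2)\<close>
    applies.\<close>
  have "(\<lambda>j. (J \<circ> T) (w j)) \<longlonglongrightarrow> (J \<circ> T) x"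
    using T(1) w x by (intro continuous_on_tendsto_compose[of _ "J \<circ> T"]) auto
  then have "J x \<le> J (T x)"
    using z(3,4) by (intro LIMSEQ_le[OF z(4), of "\<lambda>j. J (T (w j))"]) auto
  then show min: "is_arg_min J (\<lambda>y. y \<in> (+) x ` V) x"
    using T(2) by (meson leD)
  have "\<And>j. z j \<in> {y. J y \<le> c}"
    using z(1) by auto
  then obtain y s where y: "J y \<le> c" and s: "strict_mono s" "(z \<circ> s) \<longlonglongrightarrow> y"
    using seq_compactE[of "{y. J y \<le> c}" z] K(1) by (auto simp: compact_eq_seq_compact_metric)
  have dom: "J a \<le> c \<Longrightarrow> a \<in> effective_domain J" for a
    using K(2) by (auto simp: effective_domain_def)
  \<comment> \<open>All these points and \<open>y\<close> lie in the sublevel set, hence in the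
    domain, where \<open>J\<close> is continuous. Lower semicontinuity alone would allow the energy
    to drop in the limit.\<close>
  have "(\<lambda>j. J ((z \<circ> s) j)) \<longlonglongrightarrow> J y"
    using J s(2) y dom z(1) by (intro continuous_on_tendsto_compose[of _ J]) (auto simp: o_def)
  moreover have "(\<lambda>j. J ((z \<circ> s) j)) \<longlonglongrightarrow> J x"
    using LIMSEQ_subseq_LIMSEQ[OF z(4) s(1)] by (simp add: o_def)
  ultimately have eq: "J y = J x"
    by (rule LIMSEQ_unique)
  \<comment> \<open>A subspace of a finite-dimensional space is closed, so the limit of the
    differences stays in \<open>V\<close>.\<close>
  have "(\<lambda>j. (z \<circ> s) j - (w \<circ> s) j) \<longlonglongrightarrow> y - x"
    by (intro tendsto_diff s LIMSEQ_subseq_LIMSEQ w)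
  then have yx: "y - x \<in> V"
    by (rule closed_sequentially[OF closed_subspace[OF V], rotated]) (use z(2) in auto)
  \<comment> \<open>Any direction that reaches the minimal energy \<open>J x\<close> is itself a
    minimizer; both \<open>y - x\<close> and \<open>0\<close> are of this kind.\<close>
  have "is_arg_min (\<lambda>v. J (x + v)) (\<lambda>v. v \<in> V) v" if "v \<in> V" "J (x + v) = J x" for v
    using min that by (auto simp: is_arg_min_def)
  from this[of "y - x"] this[of 0]
  have "is_arg_min (\<lambda>v. J (x + v)) (\<lambda>v. v \<in> V) (y - x)"
    "is_arg_min (\<lambda>v. J (x + v)) (\<lambda>v. v \<in> V) 0"
    using yx eq subspace_0[OF V] by simp_all
  with uniq have "y - x = 0"
    by blast
  then have "y = x"
    by simp
  with s show "\<exists>s :: nat \<Rightarrow> nat. strict_mono s \<and> (z \<circ> s) \<longlonglongrightarrow> x"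
    by blast
qed

theorem corollary4p3:
  fixes J :: "real ^ 'n \<Rightarrow> ereal"
    and m :: nat
    and V :: "nat \<Rightarrow> (real ^ 'n) set"
    and M M' :: "nat \<Rightarrow> real ^ 'n \<Rightarrow> real ^ 'n"
    and C :: "real ^ 'n \<Rightarrow> real ^ 'n"
    and u :: "nat \<Rightarrow> real ^ 'n"
    and x :: "real ^ 'n"
  assumes "coercive J" and "proper J" and "lower_semicontinuous J"
    and "continuous_on (effective_domain J) J"
    and "\<And>k. k \<in> {1..m} \<Longrightarrow> subspace (V k)"
    and "(\<Sum>k\<in>{1..m}. V k) = UNIV"
    and "\<And>w k. w \<in> effective_domain J \<Longrightarrow> k \<in> {1..m} \<Longrightarrow>
           \<exists>!v. is_arg_min (\<lambda>v. J (w + v)) (\<lambda>v. v \<in> V k) v"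
    and "compatible J m V"
    and "\<And>k. k \<in> {1..m} \<Longrightarrow> M k \<in> effective_domain J \<rightarrow> effective_domain J"
    and "\<And>k w. k \<in> {1..m} \<Longrightarrow> w \<in> effective_domain J \<Longrightarrow> M k w - w \<in> V k"
    and "C \<in> effective_domain J \<rightarrow> effective_domain J"
    and "u 0 \<in> effective_domain J"
    and "\<And>\<nu>. u (Suc \<nu>) = C (fold M [1..<Suc m] (u \<nu>))"
    and "\<And>k. k \<in> {1..m} \<Longrightarrow> M' k \<in> effective_domain J \<rightarrow> effective_domain J"
    and "\<And>k w. k \<in> {1..m} \<Longrightarrow> w \<in> effective_domain J \<Longrightarrow> M' k w - w \<in> V k"
    and "\<And>k v. k \<in> {1..m} \<Longrightarrow> v \<in> effective_domain J \<Longrightarrow>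
           J (M k v) \<le> J (M' k v) \<and> J (M' k v) \<le> J v"
    and "\<And>v. v \<in> effective_domain J \<Longrightarrow> J (C v) \<le> J v"
    and "\<And>k. k \<in> {1..m} \<Longrightarrow> continuous_on (effective_domain J) (J \<circ> M' k)"
    and "\<And>k v. k \<in> {1..m} \<Longrightarrow> v \<in> effective_domain J \<Longrightarrow>
           \<not> is_arg_min J (\<lambda>y. y \<in> (+) v ` V k) v \<Longrightarrow> J (M' k v) < J v"
    and "accumulation_point u x"
  shows "is_arg_min J (\<lambda>_. True) x"
proof -
  note VS = assms(5) and uniq = assms(7) and M_dom = assms(9) and M_V = assms(10)
    and C_dom = assms(11) and u_Suc = assms(13) and M_le = assms(16) and C_le = assms(17)
    and M'_cont = assms(18) and M'_less = assms(19)
  define D where "D = effective_domain J"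
  \<comment> \<open>With the upper end \<open>Suc k\<close>, exactly \<open>M 1\<close> to
    \<open>M k\<close> are applied, in this order: \<open>w 0\<close> is \<open>u\<close>, and
    \<open>w m\<close> is what \<open>C\<close> receives.\<close>
  define w where "w k \<nu> = fold M [1..<Suc k] (u \<nu>)" for k \<nu>
  have w_0: "w 0 = u" and w_Suc: "w (Suc k) \<nu> = M (Suc k) (w k \<nu>)"
    and u_C: "u (Suc \<nu>) = C (w m \<nu>)" for k \<nu>
    by (auto simp: w_def u_Suc)
  have w_D': "w k \<nu> \<in> D" if "u \<nu> \<in> D" "k \<le> m" for k \<nu>
    using that(2)
  proof (induction k)
    case 0
    then show ?case using that(1) by (simp add: w_0)
  next
    case (Suc k)
    then show ?case using M_dom[of "Suc k"] by (auto simp: w_Suc D_def)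
  qed
  have u_D: "u \<nu> \<in> D" for \<nu>
  proof (induction \<nu>)
    case 0
    then show ?case using assms(12) by (simp add: D_def)
  next
    case (Suc \<nu>)
    then show ?case using C_dom w_D'[of \<nu> m] by (auto simp: u_C D_def)
  qed
  note w_D = w_D'[OF u_D]
  have step: "J (w (Suc k) \<nu>) \<le> J (M' (Suc k) (w k \<nu>))" "J (w (Suc k) \<nu>) \<le> J (w k \<nu>)"
    if "Suc k \<le> m" for k \<nu>
    using M_le[of "Suc k" "w k \<nu>"] w_D[of k \<nu>] that by (auto simp: w_Suc D_def)
  have antimono: "J (w l \<nu>) \<le> J (w k \<nu>)" if "k \<le> l" "l \<le> m" for k l \<nu>
    using that
  proof (induction l rule: dec_induct)
    case (step l)
    then show ?case using \<open>\<And>k \<nu>. Suc k \<le> m \<Longrightarrow> J (w (Suc k) \<nu>) \<le> J (w k \<nu>)\<close>[of l \<nu>] by auto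
  qed simp
  have w_le: "J (w k \<nu>) \<le> J (u \<nu>)" if "k \<le> m" for k \<nu>
    using antimono[of 0 k \<nu>] that by (simp add: w_0)
  \<comment> \<open>Since \<open>C\<close> does not raise the energy, each intermediate energy lies
    between two consecutive values along \<open>u\<close>. This squeeze later gives all
    \<open>w k\<close> the same limiting energy.\<close>
  have w_ge: "J (u (Suc \<nu>)) \<le> J (w k \<nu>)" if "k \<le> m" for k \<nu>
    using C_le[of "w m \<nu>"] w_D[of m \<nu>] antimono[of k m \<nu>] that by (auto simp: u_C D_def)
  have decr: "decseq (\<lambda>\<nu>. J (u \<nu>))"
    using w_le[of m] w_ge[of m] by (intro decseq_SucI) (meson order.refl order.trans)
  have u_le: "J (u \<nu>) \<le> J (u 0)" for \<nu>
    using decr by (auto simp: decseq_def)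
  have c: "J (u 0) < \<infinity>"
    using u_D[of 0] by (auto simp: D_def effective_domain_def)
  have K: "compact {y. J y \<le> J (u 0)}"
    using assms(1,3) c by (rule compact_sublevel)
  obtain r where r: "strict_mono r" "(u \<circ> r) \<longlonglongrightarrow> x"
    using assms(20) unfolding accumulation_point_def by blast
  \<comment> \<open>A limit of points of the domain could have infinite energy; closedness of the
    sublevel set rules this out.\<close>
  have "x \<in> {y. J y \<le> J (u 0)}"
    using u_le by (intro closed_sequentially[OF compact_imp_closed[OF K] _ r(2)]) auto
  with c have x_D: "x \<in> D"
    by (auto simp: D_def effective_domain_def)
  \<comment> \<open>Monotonicity makes the whole energy sequence converge to its infimum, and the
    subsequence identifies this infimum as \<open>J x\<close>.\<close>
  have "(\<lambda>j. J ((u \<circ> r) j)) \<longlonglongrightarrow> J x"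
    using assms(4) r(2) x_D u_D by (intro continuous_on_tendsto_compose[of _ J]) (auto simp: D_def o_def)
  moreover have lim: "(\<lambda>\<nu>. J (u \<nu>)) \<longlonglongrightarrow> (INF \<nu>. J (u \<nu>))"
    using decr by (rule LIMSEQ_INF)
  ultimately have "(INF \<nu>. J (u \<nu>)) = J x"
    using LIMSEQ_subseq_LIMSEQ[OF lim r(1)] by (intro LIMSEQ_unique) (auto simp: o_def)
  with lim have u_lim: "(\<lambda>\<nu>. J (u \<nu>)) \<longlonglongrightarrow> J x"
    by simp
  have w_lim: "(\<lambda>\<nu>. J (w k \<nu>)) \<longlonglongrightarrow> J x" if "k \<le> m" for k
    using w_ge[OF that] w_le[OF that]
    by (intro tendsto_sandwich[OF _ _ LIMSEQ_Suc[OF u_lim] u_lim]) auto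
  have next_step: "is_arg_min J (\<lambda>y. y \<in> (+) x ` V (Suc k)) x"
      "\<exists>t :: nat \<Rightarrow> nat. strict_mono t \<and> ((w (Suc k) \<circ> s) \<circ> t) \<longlonglongrightarrow> x"
    if k: "Suc k \<le> m" and s: "strict_mono s" "(w k \<circ> s) \<longlonglongrightarrow> x" for k s
  proof -
    have mem: "Suc k \<in> {1..m}" and D: "(w k \<circ> s) j \<in> effective_domain J" for j
      using k w_D[of k] by (auto simp: D_def)
    have x: "x \<in> effective_domain J"
      using x_D by (simp add: D_def)
    have le: "J ((w (Suc k) \<circ> s) j) \<le> J (u 0)" for j
      using w_le[OF k] u_le order.trans by fastforce
    have diff: "(w (Suc k) \<circ> s) j - (w k \<circ> s) j \<in> V (Suc k)" for j
      using M_V[OF mem D[of j]] by (simp add: w_Suc)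
    have M': "J ((w (Suc k) \<circ> s) j) \<le> J (M' (Suc k) ((w k \<circ> s) j))" for j
      using step(1)[OF k] by simp
    have lim: "(\<lambda>j. J ((w (Suc k) \<circ> s) j)) \<longlonglongrightarrow> J x"
      using LIMSEQ_subseq_LIMSEQ[OF w_lim[OF k] s(1)] by (simp add: o_def)
    note * = subspace_step[OF K c assms(4) VS[OF mem] x uniq[OF x mem] M'_cont[OF mem]
        M'_less[OF mem x] D s(2) le diff M' lim]
    show "is_arg_min J (\<lambda>y. y \<in> (+) x ` V (Suc k)) x"
      by (rule *(1))
    show "\<exists>t :: nat \<Rightarrow> nat. strict_mono t \<and> ((w (Suc k) \<circ> s) \<circ> t) \<longlonglongrightarrow> x"
      by (rule *(2))
  qed
  \<comment> \<open>The subsequence is refined at each step and so depends on \<open>k\<close>, but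
    its limit is the same \<open>x\<close> for all \<open>k\<close>.\<close>
  have subseq: "\<exists>s :: nat \<Rightarrow> nat. strict_mono s \<and> (w k \<circ> s) \<longlonglongrightarrow> x" if "k \<le> m" for k
    using that
  proof (induction k)
    case 0
    then show ?case using r unfolding w_0 by blast
  next
    case (Suc k)
    then obtain s :: "nat \<Rightarrow> nat" where s: "strict_mono s" "(w k \<circ> s) \<longlonglongrightarrow> x"
      using Suc_leD by blast
    then obtain t :: "nat \<Rightarrow> nat" where "strict_mono t" "((w (Suc k) \<circ> s) \<circ> t) \<longlonglongrightarrow> x"
      using next_step(2)[OF Suc.prems] by blast
    with s(1) show ?case
      by (metis comp_assoc strict_mono_o)
  qed
  \<comment> \<open>Minimality along \<open>V k\<close> comes from the iterates just before step
    \<open>k\<close>, hence the predecessor \<open>l\<close>.\<close>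
  have "J x \<le> J (x + v)" if "k \<in> {1..m}" "v \<in> V k" for k v
  proof -
    obtain l where l: "k = Suc l" "Suc l \<le> m"
      using \<open>k \<in> {1..m}\<close> by (cases k) auto
    then obtain s where "strict_mono s" "(w l \<circ> s) \<longlonglongrightarrow> x"
      using subseq[of l] Suc_leD by blast
    with l \<open>v \<in> V k\<close> show ?thesis
      using next_step(1)[of l s] by (auto simp: is_arg_min_def not_less)
  qed
  with assms(8) x_D have "J x \<le> J (x + v)" for v
    unfolding compatible_def D_def by blast
  from this[of "y - x" for y] show ?thesis
    by (auto simp: is_arg_min_def not_less)
qed

end
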